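(* Let $X$ be a finite dimensional Banach space over $\mathbb K$ ($\mathbb K=\mathbb R$ or $\mathbb C$), let $n$ be a positive integer, and suppose $K$ is a positive constant with $K<\frac{1}{\sqrt[n]{ne^2}}$ such that for every choice of norm one polynomials $Q_1,\ldots,Q_n:X\to\mathbb K$, of arbitrary degrees $m_1,\ldots,m_n\ge 1$, we have $$\|Q_1\cdots Q_n\|\ge K^{\sum_{i=1}^n m_i}\,\|Q_1\|\cdots\|Q_n\|.$$ Then, for any norm one polynomials $P_1,\ldots,P_n:X\to\mathbb K$ of degrees $k_1,\ldots,k_n\ge 1$ and any real numbers $a_1,\ldots,a_n\ge 0$ with $\sum_{i=1}^n a_i\leq nK^n$, there is $z_0\in B_X$ such that $$|P_i(z_0)|\geq a_i^{k_i}\quad\text{for } i=1,\ldots,n.$$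
   Context: $B_X$ denotes the (closed) unit ball of $X$. A function $P:X\to\mathbb K$ is a continuous $k$-homogeneous polynomial if there is a continuous $k$-linear function $T:X\times\cdots\times X\to\mathbb K$ with $P(z)=T(z,\ldots,z)$. A function $Q:X\to\mathbb K$ is a continuous polynomial of degree $k$ if $Q=\sum_{l=0}^k Q_l$ with $Q_0$ constant, $Q_l$ a continuous $l$-homogeneous polynomial for $1\le l\le k$, and $Q_k\ne 0$. The norm of a polynomial is $\|Q\|=\sup_{z\in B_X}|Q(z)|$, and products are pointwise. *)

theory Defs
  imports "HOL-Analysis.Analysis"
begin

text \<open>The scalar fields: up to isometric isomorphism, exactly the types \<^typ>\<open>real\<close>
  and \<^typ>\<open>complex\<close>, both of which are instances.\<close>

class real_or_complex = real_normed_field +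
  assumes real_or_complex:
    "(\<exists>f :: 'a \<Rightarrow> real. bij f \<and>
        (\<forall>x y. f (x + y) = f x + f y) \<and> (\<forall>r x. f (r *\<^sub>R x) = r *\<^sub>R f x) \<and>
        (\<forall>x y. f (x * y) = f x * f y) \<and> (\<forall>x. norm (f x) = norm x)) \<or>
     (\<exists>f :: 'a \<Rightarrow> complex. bij f \<and>
        (\<forall>x y. f (x + y) = f x + f y) \<and> (\<forall>r x. f (r *\<^sub>R x) = r *\<^sub>R f x) \<and>
        (\<forall>x y. f (x * y) = f x * f y) \<and> (\<forall>x. norm (f x) = norm x))"

instance real :: real_or_complex
  by standard (rule disjI1, rule exI[of _ id], simp)

instance complex :: real_or_complex
  by standard (rule disjI2, rule exI[of _ id], simp)

text \<open>HOL-Analysis only has normed spaces over the reals. A normed space over the scalar field is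
  a real normed space whose scalar multiplication extends to that field, compatibly with the
  norm.\<close>

locale normed_space_over = vector_space scl
  for scl :: "'k::real_or_complex \<Rightarrow> 'a::real_normed_vector \<Rightarrow> 'a" +
  assumes scl_of_real: "scl (of_real r) x = r *\<^sub>R x"
    and norm_scl: "norm (scl c x) = norm c * norm x"

lemma normed_space_over_scaleR:
  "normed_space_over ((*\<^sub>R) :: real \<Rightarrow> 'a::real_normed_vector \<Rightarrow> 'a)"
  by unfold_locales (auto simp: algebra_simps)

lemma normed_space_over_times:
  "normed_space_over ((*) :: 'k::real_or_complex \<Rightarrow> 'k \<Rightarrow> 'k)"
  by unfold_locales (auto simp: algebra_simps norm_mult scaleR_conv_of_real)

text \<open>The \<open>k\<close>-fold power of the space is the set of functions on \<open>{..<k}\<close> that are \<open>undefined\<close>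
  outside it; the topology it inherits from the function type is the product topology.\<close>

definition continuous_multilinear_form ::
    "('k::real_or_complex \<Rightarrow> 'a::real_normed_vector \<Rightarrow> 'a) \<Rightarrow> nat \<Rightarrow> ((nat \<Rightarrow> 'a) \<Rightarrow> 'k) \<Rightarrow> bool"
  where "continuous_multilinear_form scl k T \<longleftrightarrow>
    continuous_on ({..<k} \<rightarrow>\<^sub>E UNIV) T \<and>
    (\<forall>x \<in> {..<k} \<rightarrow>\<^sub>E UNIV. \<forall>i<k. Vector_Spaces.linear scl (*) (\<lambda>v. T (x(i := v))))"

definition continuous_homogeneous_polynomial ::
    "('k::real_or_complex \<Rightarrow> 'a::real_normed_vector \<Rightarrow> 'a) \<Rightarrow> nat \<Rightarrow> ('a \<Rightarrow> 'k) \<Rightarrow> bool"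
  where "continuous_homogeneous_polynomial scl k P \<longleftrightarrow>
    (\<exists>T. continuous_multilinear_form scl k T \<and> (\<forall>z. P z = T (\<lambda>i\<in>{..<k}. z)))"

definition continuous_polynomial_of_degree ::
    "('k::real_or_complex \<Rightarrow> 'a::real_normed_vector \<Rightarrow> 'a) \<Rightarrow> nat \<Rightarrow> ('a \<Rightarrow> 'k) \<Rightarrow> bool"
  where "continuous_polynomial_of_degree scl k Q \<longleftrightarrow>
    (\<exists>q :: nat \<Rightarrow> 'a \<Rightarrow> 'k.
      (\<exists>c. \<forall>z. q 0 z = c) \<and>
      (\<forall>l\<in>{1..k}. continuous_homogeneous_polynomial scl l (q l)) \<and>
      q k \<noteq> (\<lambda>z. 0) \<and>
      (\<forall>z. Q z = (\<Sum>l=0..k. q l z)))"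

definition poly_norm :: "('a::real_normed_vector \<Rightarrow> 'k::real_normed_vector) \<Rightarrow> real"
  where "poly_norm Q = (SUP z\<in>cball 0 1. norm (Q z))"

end

theory Submission
  imports Defs
begin

text \<open>
  If \<open>Q\<^sub>1, \<dots>, Q\<^sub>n\<close> have norm one, then at a point where their product is at least
  \<open>K ^ M\<close>, with \<open>M\<close> the total degree, every single factor is at least \<open>K ^ M\<close> in modulus, since
  the other factors are at most one. Applied to \<open>Q\<^sub>i = P\<^sub>i ^ m\<^sub>i\<close> this bounds \<open>\<bar>P\<^sub>i\<bar>\<close> from below by
  \<open>K powr (M / m\<^sub>i)\<close>, so only the shares \<open>w\<^sub>i = k\<^sub>i m\<^sub>i / M\<close> of the total degree matter. The shares
  are rational, but the unit ball is compact, so a limit argument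
  (\<open>ex_weighted_point\<close>) gives, for all real \<open>w\<^sub>i \<ge> 0\<close> with sum at most one, a single point of the
  ball at which \<open>\<bar>P\<^sub>i\<bar> \<ge> K powr (k\<^sub>i / w\<^sub>i)\<close> whenever \<open>w\<^sub>i > 0\<close>.

  For \<open>a\<^sub>i > 0\<close> the right-hand side is \<open>a\<^sub>i ^ k\<^sub>i\<close> exactly when \<open>w\<^sub>i = ln K / ln a\<^sub>i\<close>. It remains to see that
  these weights have sum at most one, that is, \<open>\<Sum>\<^sub>i -1 / ln a\<^sub>i \<le> -1 / ln K\<close>
  (\<open>sum_ln_ratio_le\<close>). Between zero and one the function \<open>-1 / ln\<close> is increasing, and it is
  concave precisely up to \<open>exp (-2)\<close>. Since \<open>\<Sum>\<^sub>i a\<^sub>i \<le> n K ^ n < exp (-2)\<close>, Jensen's inequality at the mean, which is at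
  most \<open>K ^ n\<close>, bounds the sum by \<open>n\<close> times \<open>-1 / ln (K ^ n)\<close>, which is \<open>-1 / ln K\<close>.

  Two facts are needed to apply this: the unit ball is compact
  (\<open>compact_cball_finite_dimensional\<close>), and a power of a polynomial is a polynomial of the expected
  degree (\<open>continuous_polynomial_of_degree_power\<close>).
\<close>

section \<open>Compactness of balls in finite dimension\<close>

lemma compact_cball_isometric:
  fixes f :: "'a::real_normed_vector \<Rightarrow> 'b::{real_normed_vector, heine_borel}"
  assumes "bij f" and add: "\<And>x y. f (x + y) = f x + f y" and norm: "\<And>x. norm (f x) = norm x"
  shows "compact (cball (0::'a) r)"
proof -
  have inv: "f (inv f u) = u" for u using \<open>bij f\<close> by (simp add: bij_is_surj surj_f_inv_f)
  have diff: "f (x - y) = f x - f y" for x y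
    using add[of "x - y" y] by simp
  have "dist (inv f u) (inv f v) = dist u v" for u v
    unfolding dist_norm using norm[of "inv f u - inv f v"] by (simp add: diff inv)
  then have "continuous_on (cball 0 r) (inv f)"
    unfolding continuous_on_iff by metis
  then have "compact (inv f ` cball 0 r)"
    by (intro compact_continuous_image compact_cball)
  moreover have "inv f ` cball 0 r = cball 0 r"
  proof (intro subset_antisym subsetI)
    fix x assume "x \<in> inv f ` cball 0 r"
    then show "x \<in> cball 0 r" using norm by (auto simp: inv simp flip: norm)
  next
    fix x :: 'a assume "x \<in> cball 0 r"
    then have "f x \<in> cball 0 r" "x = inv f (f x)"
      using \<open>bij f\<close> by (auto simp: norm bij_is_inj)
    then show "x \<in> inv f ` cball 0 r" by blast
  qed
  ultimately show ?thesis by simp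
qed

lemma compact_cball_scalar: "compact (cball (0::'k::real_or_complex) r)"
  using real_or_complex[where 'a='k] compact_cball_isometric by metis

context normed_space_over
begin

lemma bounded_linear_scl_left: "bounded_linear (\<lambda>c. scl c x)"
proof (rule bounded_linear_intro)
  show "scl (c + d) x = scl c x + scl d x" for c d by (rule scale_left_distrib)
  show "scl (r *\<^sub>R c) x = r *\<^sub>R scl c x" for r c
    by (metis scaleR_conv_of_real scale_scale scl_of_real)
  show "norm (scl c x) \<le> norm c * norm x" for c by (simp add: norm_scl)
qed

lemma continuous_on_coordinate_sum: "continuous_on A (\<lambda>c. \<Sum>b\<in>B. scl (c b) b)"
  by (intro continuous_on_sum bounded_linear.continuous_on[OF bounded_linear_scl_left]
      continuous_on_subset[OF continuous_on_product_coordinates]) simp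

text \<open>Coefficient families are functions on the whole space that vanish off \<open>B\<close>; requiring this
  makes the box a product of compact sets over all indices, so that Tychonoff's theorem applies.\<close>

lemma compact_coordinate_box:
  assumes "\<And>b. b \<in> B \<Longrightarrow> compact (S b)"
  shows "compact (PiE UNIV (\<lambda>b::'a. if b \<in> B then S b else {0::'k}))"
proof -
  have "compactin (product_topology (\<lambda>_. euclidean) UNIV)
      (PiE UNIV (\<lambda>b::'a. if b \<in> B then S b else {0::'k}))"
    unfolding compactin_PiE using assms by auto
  then show ?thesis by (simp add: euclidean_product_topology)
qed

text \<open>The families with coefficients in the unit ball and \<open>\<bar>c b\<bar> = 1\<close> form a compact set, on which
  the norm of the linear combination is continuous and, by independence, never zero. So it has a
  positive minimum.\<close>

lemma coordinate_bound_single: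
  assumes "finite B" "independent B" "b \<in> B"
  obtains d where "d > 0" "\<And>c. (\<And>b'. b' \<in> B \<Longrightarrow> norm (c b') \<le> 1) \<Longrightarrow> norm (c b) = 1 \<Longrightarrow>
    (\<And>b'. b' \<notin> B \<Longrightarrow> c b' = 0) \<Longrightarrow> d \<le> norm (\<Sum>b\<in>B. scl (c b) b)"
proof -
  define S where "S = PiE UNIV (\<lambda>b'. if b' \<in> B then
      (if b' = b then sphere 0 1 else cball (0::'k) 1) else {0})"
  have "closed (sphere (0::'k) 1)"
    unfolding sphere_def by (intro closed_Collect_eq continuous_intros)
  with compact_cball_scalar[of 1] have "compact (cball (0::'k) 1 \<inter> sphere 0 1)"
    by (rule compact_Int_closed)
  then have "compact (sphere (0::'k) 1)" by (simp add: inf.absorb2)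
  then have "compact S"
    unfolding S_def by (intro compact_coordinate_box) (simp add: compact_cball_scalar)
  have "(\<lambda>b'. if b' = b then 1 else 0) \<in> S"
    using \<open>b \<in> B\<close> by (auto simp: S_def)
  then have "S \<noteq> {}" by blast
  with \<open>compact S\<close> have "\<exists>c\<in>S. \<forall>c'\<in>S. norm (\<Sum>b\<in>B. scl (c b) b) \<le> norm (\<Sum>b\<in>B. scl (c' b) b)"
    by (intro continuous_attains_inf continuous_on_norm continuous_on_coordinate_sum)
  then obtain c where c: "c \<in> S"
    "\<And>c'. c' \<in> S \<Longrightarrow> norm (\<Sum>b\<in>B. scl (c b) b) \<le> norm (\<Sum>b\<in>B. scl (c' b) b)"
    by blast
  have "norm (c b) = 1"
    using c(1) \<open>b \<in> B\<close> by (auto simp: S_def PiE_def Pi_def split: if_splits)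
  then have "(\<Sum>b\<in>B. scl (c b) b) \<noteq> 0"
    using independentD[OF assms(2,1) order_refl, of c b] \<open>b \<in> B\<close> by auto
  then show thesis
    by (intro that[of "norm (\<Sum>b\<in>B. scl (c b) b)"] c(2)) (auto simp: S_def)
qed

text \<open>Up to a constant factor, the norm dominates the maximum norm of the coordinates: after division by a coefficient of
  maximal modulus, a family becomes one of those treated above.\<close>

lemma coordinate_bound:
  assumes "finite B" "independent B"
  obtains d where "d > 0" "\<And>c b. b \<in> B \<Longrightarrow> d * norm (c b) \<le> norm (\<Sum>b\<in>B. scl (c b) b)"
proof -
  define bound where "bound = (\<lambda>d b. \<forall>c. (\<forall>b'\<in>B. norm (c b') \<le> 1) \<longrightarrow> norm (c b) = 1 \<longrightarrow>
    (\<forall>b'. b' \<notin> B \<longrightarrow> c b' = 0) \<longrightarrow> d \<le> norm (\<Sum>b\<in>B. scl (c b) b))"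
  have "\<exists>d. d > 0 \<and> bound d b" if "b \<in> B" for b
    by (rule coordinate_bound_single[OF assms that]) (auto simp: bound_def)
  then have "\<exists>e. \<forall>b\<in>B. e b > 0 \<and> bound (e b) b" by (intro bchoice ballI)
  then obtain e where
    e: "\<And>b. b \<in> B \<Longrightarrow> e b > 0" "\<And>b. b \<in> B \<Longrightarrow> bound (e b) b"
    by auto
  define d where "d = Min (insert 1 (e ` B))"
  have d: "d > 0" "\<And>b. b \<in> B \<Longrightarrow> d \<le> e b"
    using \<open>finite B\<close> e(1) by (auto simp: d_def)
  have "d * norm (c b) \<le> norm (\<Sum>b\<in>B. scl (c b) b)" if "b \<in> B" for c b
  proof (cases "c b = 0")
    case False
    have "Max ((\<lambda>b. norm (c b)) ` B) \<in> (\<lambda>b. norm (c b)) ` B"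
      using \<open>finite B\<close> \<open>b \<in> B\<close> by (intro Max_in) auto
    then obtain b0 where "b0 \<in> B" "norm (c b0) = Max ((\<lambda>b. norm (c b)) ` B)" by auto
    then have b0: "b0 \<in> B" "\<And>b'. b' \<in> B \<Longrightarrow> norm (c b') \<le> norm (c b0)"
      using \<open>finite B\<close> by auto
    have "0 < norm (c b)" using False by simp
    then have pos: "0 < norm (c b0)" using b0(2)[OF \<open>b \<in> B\<close>] by (rule less_le_trans)
    define c' where "c' = (\<lambda>b. if b \<in> B then inverse (c b0) * c b else 0)"
    have "norm (c' b') \<le> 1" if "b' \<in> B" for b'
    proof -
      have "norm (c' b') = inverse (norm (c b0)) * norm (c b')"
        using that by (simp only: c'_def if_True norm_mult norm_inverse)
      also have "\<dots> \<le> 1" using b0(2)[OF that] pos by (simp add: inverse_eq_divide)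
      finally show ?thesis .
    qed
    moreover have "norm (c' b0) = 1" using b0(1) pos by (simp add: c'_def)
    moreover have "c' b' = 0" if "b' \<notin> B" for b' using that by (simp add: c'_def)
    ultimately have "e b0 \<le> norm (\<Sum>b\<in>B. scl (c' b) b)"
      using e(2)[OF b0(1)] by (simp add: bound_def)
    also have "(\<Sum>b\<in>B. scl (c' b) b) = scl (inverse (c b0)) (\<Sum>b\<in>B. scl (c b) b)"
      by (simp add: c'_def scale_sum_right)
    finally have "e b0 * norm (c b0) \<le> norm (\<Sum>b\<in>B. scl (c b) b)"
      using pos unfolding norm_scl norm_inverse by (simp add: field_simps)
    moreover have "d * norm (c b) \<le> e b0 * norm (c b0)"
      using d b0 \<open>b \<in> B\<close> e(1)[OF b0(1)] by (intro mult_mono) auto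
    ultimately show ?thesis by linarith
  qed simp
  then show thesis using that d(1) by blast
qed

text \<open>By the coordinate bound, the ball is a closed part of the continuous image of a compact box of
  coefficients.\<close>

lemma compact_cball_finite_dimensional:
  assumes "finite_dimensional_vector_space scl B"
  shows "compact (cball (0::'a) r)"
proof -
  interpret finite_dimensional_vector_space scl B by fact
  obtain d where d: "d > 0" "\<And>c b. b \<in> B \<Longrightarrow> d * norm (c b) \<le> norm (\<Sum>b\<in>B. scl (c b) b)"
    using coordinate_bound[OF finite_Basis independent_Basis] by blast
  define S where "S = PiE UNIV (\<lambda>b. if b \<in> B then cball (0::'k) (r / d) else {0})"
  let ?h = "\<lambda>c. \<Sum>b\<in>B. scl (c b) b"
  have "compact (?h ` S)"
    unfolding S_def
    by (intro compact_continuous_image continuous_on_coordinate_sum compact_coordinate_box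
        compact_cball_scalar)
  moreover have "cball 0 r \<subseteq> ?h ` S"
  proof
    fix x :: 'a assume x: "x \<in> cball 0 r"
    have "x \<in> span B" by (simp add: span_Basis)
    then obtain u where u: "x = ?h u"
      by (auto simp: span_finite[OF finite_Basis])
    define c where "c = (\<lambda>b. if b \<in> B then u b else 0)"
    have xc: "x = ?h c" by (simp add: u c_def)
    have "norm (c b) \<le> r / d" if "b \<in> B" for b
      using d(2)[OF that, of c] x d(1) xc by (simp add: field_simps)
    then have "c \<in> S" by (auto simp: S_def c_def)
    then show "x \<in> ?h ` S" using xc by blast
  qed
  ultimately show ?thesis
    using compact_Int_closed[OF _ closed_cball, of "?h ` S" 0 r] by (simp only: inf.absorb2)
qed

end

section \<open>Powers of polynomials\<close>

lemma continuous_on_homogeneous_polynomial: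
  fixes scl :: "'k::real_or_complex \<Rightarrow> 'a::real_normed_vector \<Rightarrow> 'a"
  assumes "continuous_homogeneous_polynomial scl k p"
  shows "continuous_on A p"
proof -
  obtain T where T: "continuous_on ({..<k} \<rightarrow>\<^sub>E UNIV) T" "\<And>z. p z = T (\<lambda>i\<in>{..<k}. z)"
    using assms unfolding continuous_homogeneous_polynomial_def continuous_multilinear_form_def
    by blast
  have "continuous_on A (\<lambda>z::'a. \<lambda>i\<in>{..<k}. z)"
  proof (rule continuous_on_coordinatewise_then_product)
    show "continuous_on A (\<lambda>z::'a. (\<lambda>i\<in>{..<k}. z) i)" for i by (cases "i < k") auto
  qed
  then have "continuous_on A (\<lambda>z. T (\<lambda>i\<in>{..<k}. z))"
    by (rule continuous_on_compose2[OF T(1)]) (auto split: if_splits)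
  then show ?thesis by (simp add: T(2)[abs_def])
qed

text \<open>A form with no arguments is a constant, so that the constant term of a polynomial needs no
  separate treatment below.\<close>

lemma continuous_homogeneous_polynomial_0_iff:
  "continuous_homogeneous_polynomial scl 0 p \<longleftrightarrow> (\<exists>c. \<forall>z. p z = c)"
proof
  assume "\<exists>c. \<forall>z. p z = c"
  then obtain c where c: "\<And>z. p z = c" by blast
  show "continuous_homogeneous_polynomial scl 0 p"
    unfolding continuous_homogeneous_polynomial_def continuous_multilinear_form_def
    by (rule exI[of _ "\<lambda>_. c"]) (simp add: c)
qed (force simp: continuous_homogeneous_polynomial_def restrict_def)

lemma continuous_homogeneous_polynomial_sum:
  fixes scl :: "'k::real_or_complex \<Rightarrow> 'a::real_normed_vector \<Rightarrow> 'a"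
  assumes "vector_space scl"
    and "\<And>i. i \<in> I \<Longrightarrow> continuous_homogeneous_polynomial scl k (p i)"
  shows "continuous_homogeneous_polynomial scl k (\<lambda>z. \<Sum>i\<in>I. p i z)"
proof -
  obtain T where T: "\<And>i. i \<in> I \<Longrightarrow> continuous_multilinear_form scl k (T i)"
    "\<And>i z. i \<in> I \<Longrightarrow> p i z = T i (\<lambda>i\<in>{..<k}. z)"
    using assms(2) unfolding continuous_homogeneous_polynomial_def by metis
  have "vector_space ((*) :: 'k \<Rightarrow> 'k \<Rightarrow> 'k)"
    by unfold_locales (auto simp: algebra_simps)
  then have "continuous_multilinear_form scl k (\<lambda>x. \<Sum>i\<in>I. T i x)"
    using T(1) \<open>vector_space scl\<close> unfolding continuous_multilinear_form_def Vector_Spaces.linear_iff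
    by (auto intro!: continuous_on_sum simp: sum.distrib sum_distrib_left)
  then show ?thesis
    unfolding continuous_homogeneous_polynomial_def using T(2) by auto
qed

text \<open>The product of a \<open>k\<close>-linear form in the first \<open>k\<close> arguments and an \<open>l\<close>-linear form in the
  last \<open>l\<close> arguments is \<open>(k + l)\<close>-linear, and its diagonal is the product of the two
  diagonals.\<close>

lemma continuous_homogeneous_polynomial_mult:
  fixes scl :: "'k::real_or_complex \<Rightarrow> 'a::real_normed_vector \<Rightarrow> 'a"
  assumes "continuous_homogeneous_polynomial scl k p" "continuous_homogeneous_polynomial scl l q"
    and "vector_space scl"
  shows "continuous_homogeneous_polynomial scl (k + l) (\<lambda>z. p z * q z)"
proof -
  obtain T where T: "continuous_multilinear_form scl k T" "\<And>z. p z = T (\<lambda>i\<in>{..<k}. z)"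
    using assms(1) unfolding continuous_homogeneous_polynomial_def by blast
  obtain U where U: "continuous_multilinear_form scl l U" "\<And>z. q z = U (\<lambda>i\<in>{..<l}. z)"
    using assms(2) unfolding continuous_homogeneous_polynomial_def by blast
  let ?f = "\<lambda>x::nat \<Rightarrow> 'a. \<lambda>i\<in>{..<k}. x i" and ?g = "\<lambda>x::nat \<Rightarrow> 'a. \<lambda>i\<in>{..<l}. x (k + i)"
  have vs: "vector_space ((*) :: 'k \<Rightarrow> 'k \<Rightarrow> 'k)"
    by unfold_locales (auto simp: algebra_simps)
  have linT: "Vector_Spaces.linear scl (*) (\<lambda>v. T ((?f x)(i := v)))" if "i < k" for x i
    using T(1) that unfolding continuous_multilinear_form_def by auto
  have linU: "Vector_Spaces.linear scl (*) (\<lambda>v. U ((?g x)(i := v)))" if "i < l" for x i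
    using U(1) that unfolding continuous_multilinear_form_def by auto
  have coord: "continuous_on A (\<lambda>x. x i)" for A :: "(nat \<Rightarrow> 'a) set" and i
    by (rule continuous_on_subset[OF continuous_on_product_coordinates]) simp
  have "continuous_on ({..<k + l} \<rightarrow>\<^sub>E UNIV) (\<lambda>x. T (?f x) * U (?g x))"
  proof (rule continuous_on_mult)
    have f_cont: "continuous_on ({..<k + l} \<rightarrow>\<^sub>E UNIV) ?f"
    proof (rule continuous_on_coordinatewise_then_product)
      show "continuous_on ({..<k + l} \<rightarrow>\<^sub>E UNIV) (\<lambda>x. ?f x i)" for i
        by (cases "i < k") (auto simp: coord)
    qed
    have T_cont: "continuous_on ({..<k} \<rightarrow>\<^sub>E UNIV) T"
      using T(1) unfolding continuous_multilinear_form_def by blast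
    show "continuous_on ({..<k + l} \<rightarrow>\<^sub>E UNIV) (\<lambda>x. T (?f x))"
      by (rule continuous_on_compose2[OF T_cont f_cont]) (simp add: image_subset_iff restrict_PiE_iff)
    have g_cont: "continuous_on ({..<k + l} \<rightarrow>\<^sub>E UNIV) ?g"
    proof (rule continuous_on_coordinatewise_then_product)
      show "continuous_on ({..<k + l} \<rightarrow>\<^sub>E UNIV) (\<lambda>x. ?g x i)" for i
        by (cases "i < l") (auto simp: coord)
    qed
    have U_cont: "continuous_on ({..<l} \<rightarrow>\<^sub>E UNIV) U"
      using U(1) unfolding continuous_multilinear_form_def by blast
    show "continuous_on ({..<k + l} \<rightarrow>\<^sub>E UNIV) (\<lambda>x. U (?g x))"
      by (rule continuous_on_compose2[OF U_cont g_cont]) (simp add: image_subset_iff restrict_PiE_iff)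
  qed
  moreover have "Vector_Spaces.linear scl (*) (\<lambda>v. T (?f (x(i := v))) * U (?g (x(i := v))))"
    if "i < k + l" for x i
  proof (cases "i < k")
    case True
    then have "?f (x(i := v)) = (?f x)(i := v)" "?g (x(i := v)) = ?g x" for v
      by (auto simp: fun_eq_iff)
    then show ?thesis
      using linT[OF True, of x] \<open>vector_space scl\<close> vs by (simp add: Vector_Spaces.linear_iff algebra_simps)
  next
    case False
    then have i: "i - k < l" using that by simp
    with False have "?f (x(i := v)) = ?f x" "?g (x(i := v)) = (?g x)(i - k := v)" for v
      by (auto simp: fun_eq_iff)
    with i show ?thesis
      using linU[of "i - k" x] \<open>vector_space scl\<close> vs by (simp add: Vector_Spaces.linear_iff algebra_simps)
  qed
  ultimately have "continuous_multilinear_form scl (k + l) (\<lambda>x. T (?f x) * U (?g x))"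
    unfolding continuous_multilinear_form_def by blast
  moreover have "p z * q z = T (?f (\<lambda>i\<in>{..<k + l}. z)) * U (?g (\<lambda>i\<in>{..<k + l}. z))" for z
  proof -
    have "?f (\<lambda>i\<in>{..<k + l}. z) = (\<lambda>i\<in>{..<k}. z)" "?g (\<lambda>i\<in>{..<k + l}. z) = (\<lambda>i\<in>{..<l}. z)"
      by (auto simp: fun_eq_iff)
    then show ?thesis by (simp add: T(2) U(2))
  qed
  ultimately show ?thesis unfolding continuous_homogeneous_polynomial_def by blast
qed

text \<open>The components are padded with zeros beyond the degree, so that products of polynomials can be
  written as Cauchy products of sequences. The leading component may vanish.\<close>

definition homogeneous_components where
  "homogeneous_components scl k q Q \<longleftrightarrow>
    (\<forall>l. continuous_homogeneous_polynomial scl l (q l)) \<and> (\<forall>l>k. q l = (\<lambda>z. 0)) \<and>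
    (\<forall>z. Q z = (\<Sum>l\<le>k. q l z))"

lemma continuous_polynomial_of_degree_iff:
  fixes scl :: "'k::real_or_complex \<Rightarrow> 'a::real_normed_vector \<Rightarrow> 'a"
  assumes "vector_space scl"
  shows "continuous_polynomial_of_degree scl k Q \<longleftrightarrow>
    (\<exists>q. homogeneous_components scl k q Q \<and> q k \<noteq> (\<lambda>z. 0))"
proof
  assume "continuous_polynomial_of_degree scl k Q"
  then obtain q where q: "\<exists>c. \<forall>z. q 0 z = c"
    "\<And>l. l \<in> {1..k} \<Longrightarrow> continuous_homogeneous_polynomial scl l (q l)"
    "q k \<noteq> (\<lambda>z. 0)" "\<And>z. Q z = (\<Sum>l=0..k. q l z)"
    unfolding continuous_polynomial_of_degree_def by blast
  define q' where "q' = (\<lambda>l. if l \<le> k then q l else (\<lambda>z. 0))"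
  have zero: "continuous_homogeneous_polynomial scl l (\<lambda>z. 0)" for l
    using continuous_homogeneous_polynomial_sum[OF assms, of "{}"] by simp
  have "continuous_homogeneous_polynomial scl l (q' l)" for l
    using q(1) q(2)[of l] zero continuous_homogeneous_polynomial_0_iff[of scl "q 0"]
    by (cases "l = 0") (auto simp: q'_def)
  then have "homogeneous_components scl k q' Q"
    unfolding homogeneous_components_def by (simp add: q'_def q(4) atLeast0AtMost)
  then show "\<exists>q. homogeneous_components scl k q Q \<and> q k \<noteq> (\<lambda>z. 0)"
    using q(3) by (intro exI[of _ q']) (simp add: q'_def)
next
  assume "\<exists>q. homogeneous_components scl k q Q \<and> q k \<noteq> (\<lambda>z. 0)"
  then obtain q where "homogeneous_components scl k q Q" "q k \<noteq> (\<lambda>z. 0)" by blast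
  then show "continuous_polynomial_of_degree scl k Q"
    unfolding continuous_polynomial_of_degree_def homogeneous_components_def
    using continuous_homogeneous_polynomial_0_iff[of scl "q 0"]
    by (intro exI[of _ q]) (auto simp: atLeast0AtMost)
qed

lemma homogeneous_components_mult:
  fixes scl :: "'k::real_or_complex \<Rightarrow> 'a::real_normed_vector \<Rightarrow> 'a"
  assumes "vector_space scl"
    and p: "homogeneous_components scl k p P" and q: "homogeneous_components scl l q Q"
  shows "homogeneous_components scl (k + l) (\<lambda>r z. \<Sum>i\<le>r. p i z * q (r - i) z) (\<lambda>z. P z * Q z)"
  unfolding homogeneous_components_def
proof (intro conjI allI impI)
  fix r
  show "continuous_homogeneous_polynomial scl r (\<lambda>z. \<Sum>i\<le>r. p i z * q (r - i) z)"
  proof (rule continuous_homogeneous_polynomial_sum[OF assms(1)])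
    fix i assume "i \<in> {..r}"
    then have "i + (r - i) = r" by simp
    then show "continuous_homogeneous_polynomial scl r (\<lambda>z. p i z * q (r - i) z)"
      using continuous_homogeneous_polynomial_mult[OF _ _ assms(1), of i "p i" "r - i" "q (r - i)"]
        p q unfolding homogeneous_components_def by simp
  qed
next
  fix r assume r: "r > k + l"
  have "p i z * q (r - i) z = 0" if "i \<le> r" for i z
  proof (cases "i > k")
    case False
    then have "r - i > l" using r by simp
    then show ?thesis using q by (simp add: homogeneous_components_def)
  qed (use p in \<open>simp add: homogeneous_components_def\<close>)
  then show "(\<lambda>z. \<Sum>i\<le>r. p i z * q (r - i) z) = (\<lambda>z. 0)"
    by (intro ext sum.neutral) simp
next
  fix z
  show "P z * Q z = (\<Sum>r\<le>k + l. \<Sum>i\<le>r. p i z * q (r - i) z)"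
    using polynomial_product[of k "\<lambda>i. p i z" l "\<lambda>i. q i z" 1] p q
    unfolding homogeneous_components_def by simp
qed

text \<open>The leading component of a power is tracked explicitly. It is the power of the leading
  component, which is visibly nonzero; for a product of different polynomials one would have to show
  that nonzero homogeneous polynomials have a nonzero product.\<close>

lemma homogeneous_components_power:
  fixes scl :: "'k::real_or_complex \<Rightarrow> 'a::real_normed_vector \<Rightarrow> 'a"
  assumes "vector_space scl" and q: "homogeneous_components scl k q Q"
  shows "\<exists>p. homogeneous_components scl (k * m) p (\<lambda>z. Q z ^ m) \<and> p (k * m) = (\<lambda>z. q k z ^ m)"
proof (induction m)
  case 0
  let ?p = "\<lambda>l z. if l = 0 then 1 else 0"
  have "continuous_homogeneous_polynomial scl l (?p l)" for l
    using continuous_homogeneous_polynomial_sum[OF assms(1), of "{}"]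
    by (cases "l = 0") (auto simp: continuous_homogeneous_polynomial_0_iff)
  then show ?case
    by (intro exI[of _ ?p]) (auto simp: homogeneous_components_def)
next
  case (Suc m)
  then obtain p where p: "homogeneous_components scl (k * m) p (\<lambda>z. Q z ^ m)"
    "p (k * m) = (\<lambda>z. q k z ^ m)" by blast
  have top: "(\<Sum>i\<le>k + k * m. q i z * p (k + k * m - i) z) = q k z ^ Suc m" for z
  proof -
    have "q i z * p (k + k * m - i) z = 0" if "i \<noteq> k" "i \<le> k + k * m" for i
    proof (cases "i > k")
      case False
      then have "k + k * m - i > k * m" using that by simp
      then show ?thesis using p(1) by (simp add: homogeneous_components_def)
    qed (use q in \<open>simp add: homogeneous_components_def\<close>)
    then have "(\<Sum>i\<le>k + k * m. q i z * p (k + k * m - i) z) = (\<Sum>i\<in>{k}. q i z * p (k + k * m - i) z)"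
      by (intro sum.mono_neutral_right) auto
    then show ?thesis using p(2) by simp
  qed
  show ?case
    using homogeneous_components_mult[OF assms(1) q p(1)] top
    by (intro exI[of _ "\<lambda>r z. \<Sum>i\<le>r. q i z * p (r - i) z"]) (simp add: fun_eq_iff)
qed

lemma continuous_polynomial_of_degree_power:
  fixes scl :: "'k::real_or_complex \<Rightarrow> 'a::real_normed_vector \<Rightarrow> 'a"
  assumes "vector_space scl" "continuous_polynomial_of_degree scl k Q"
  shows "continuous_polynomial_of_degree scl (k * m) (\<lambda>z. Q z ^ m)"
proof -
  obtain q where q: "homogeneous_components scl k q Q" "q k \<noteq> (\<lambda>z. 0)"
    using assms continuous_polynomial_of_degree_iff by blast
  obtain z where "q k z \<noteq> 0" using q(2) by auto
  then have "(\<lambda>z. q k z ^ m) \<noteq> (\<lambda>z. 0)" by (metis power_not_zero)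
  then show ?thesis
    using homogeneous_components_power[OF assms(1) q(1), of m]
      continuous_polynomial_of_degree_iff[OF assms(1)] by metis
qed

lemma continuous_on_polynomial:
  fixes scl :: "'k::real_or_complex \<Rightarrow> 'a::real_normed_vector \<Rightarrow> 'a"
  assumes "vector_space scl" "continuous_polynomial_of_degree scl k Q"
  shows "continuous_on A Q"
proof -
  obtain q where q: "homogeneous_components scl k q Q"
    using assms continuous_polynomial_of_degree_iff by blast
  then have "continuous_on A (\<lambda>z. \<Sum>l\<le>k. q l z)"
    unfolding homogeneous_components_def
    by (intro continuous_on_sum continuous_on_homogeneous_polynomial) auto
  moreover have "Q = (\<lambda>z. \<Sum>l\<le>k. q l z)"
    using q by (simp add: homogeneous_components_def fun_eq_iff)
  ultimately show ?thesis by simp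
qed

section \<open>The norm of a polynomial on a compact ball\<close>

lemma poly_norm_attained:
  fixes Q :: "'a::real_normed_vector \<Rightarrow> 'k::real_normed_vector"
  assumes "compact (cball (0::'a) 1)" "continuous_on (cball 0 1) Q"
  obtains z where "z \<in> cball 0 1" "norm (Q z) = poly_norm Q"
    "\<And>y. y \<in> cball 0 1 \<Longrightarrow> norm (Q y) \<le> poly_norm Q"
proof -
  obtain z where z: "z \<in> cball 0 1" "\<And>y. y \<in> cball 0 1 \<Longrightarrow> norm (Q y) \<le> norm (Q z)"
    using continuous_attains_sup[OF assms(1) _ continuous_on_norm[OF assms(2)]]
    by (metis centre_in_cball empty_iff zero_le_one)
  have "poly_norm Q = norm (Q z)"
    unfolding poly_norm_def using z by (intro cSup_eq_maximum) auto
  then show thesis using that z by metis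
qed

lemma poly_norm_power_eq_1:
  fixes Q :: "'a::real_normed_vector \<Rightarrow> 'k::real_normed_div_algebra"
  assumes "compact (cball (0::'a) 1)" "continuous_on (cball 0 1) Q" "poly_norm Q = 1"
  shows "poly_norm (\<lambda>z. Q z ^ m) = 1"
proof -
  obtain z where z: "z \<in> cball 0 1" "norm (Q z) = 1"
    "\<And>y. y \<in> cball 0 1 \<Longrightarrow> norm (Q y) \<le> 1"
    using poly_norm_attained[OF assms(1,2)] assms(3) by metis
  then show ?thesis
    unfolding poly_norm_def
    by (intro cSup_eq_maximum) (force simp: norm_power power_le_one)+
qed

section \<open>Choosing exponents for prescribed weights\<close>

text \<open>Given weights \<open>w\<close>, the degrees \<open>k i * m i\<close> are chosen close to \<open>N * w i\<close>. The total degree is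
  then at most \<open>N + s\<close> with \<open>s\<close> independent of \<open>N\<close>, so that at a suitable point \<open>f i\<close> is at
  least \<open>K powr ((1 + s / N) * (k i / w i))\<close> whenever \<open>w i > 0\<close>. A limit point as \<open>N\<close> tends to infinity has the
  required property.\<close>

lemma ex_weighted_point:
  fixes f :: "'i \<Rightarrow> 'a::metric_space \<Rightarrow> real" and w :: "'i \<Rightarrow> real" and k :: "'i \<Rightarrow> nat"
  assumes "finite I" "compact C" "0 < K" "K < 1"
    and cont: "\<And>i. i \<in> I \<Longrightarrow> continuous_on C (f i)"
    and f01: "\<And>i z. i \<in> I \<Longrightarrow> z \<in> C \<Longrightarrow> 0 \<le> f i z \<and> f i z \<le> 1"
    and k: "\<And>i. i \<in> I \<Longrightarrow> k i \<ge> 1"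
    and w: "\<And>i. i \<in> I \<Longrightarrow> w i \<ge> 0" "(\<Sum>i\<in>I. w i) \<le> 1"
    and prod: "\<And>m. (\<And>i. i \<in> I \<Longrightarrow> m i \<ge> 1) \<Longrightarrow>
      \<exists>z\<in>C. K ^ (\<Sum>i\<in>I. k i * m i) \<le> (\<Prod>i\<in>I. f i z ^ m i)"
  shows "\<exists>z\<in>C. \<forall>i\<in>I. w i > 0 \<longrightarrow> K powr (k i / w i) \<le> f i z"
proof -
  \<comment> \<open>The summand 1 keeps the exponents positive also where \<open>w i = 0\<close>.\<close>
  define m where "m = (\<lambda>N i. nat \<lceil>real N * w i / k i\<rceil> + 1)"
  define s where "s = 2 * (\<Sum>i\<in>I. real (k i))"
  have m_ge: "real N * w i / k i \<le> m N i" for N i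
    unfolding m_def by linarith
  have m_le: "k i * m N i \<le> real N * w i + 2 * k i" if "i \<in> I" for N i
  proof -
    have "real N * w i / k i \<ge> 0" using w(1)[OF that] by simp
    then have "m N i \<le> real N * w i / k i + 2" unfolding m_def by linarith
    then have "k i * real (m N i) \<le> k i * (real N * w i / k i + 2)"
      by (intro mult_left_mono) auto
    also have "\<dots> = real N * w i + 2 * k i" using k[OF that] by (simp add: field_simps)
    finally show ?thesis by simp
  qed
  have "(\<Sum>i\<in>I. k i * m N i) \<le> N + s" for N
  proof -
    have "(\<Sum>i\<in>I. k i * m N i) \<le> (\<Sum>i\<in>I. real N * w i + 2 * k i)"
      unfolding of_nat_sum using m_le by (intro sum_mono) simp
    also have "\<dots> = N * (\<Sum>i\<in>I. w i) + s"
      by (simp add: sum.distrib sum_distrib_left s_def)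
    also have "\<dots> \<le> N + s" using w(2) by (simp add: mult_left_le)
    finally show ?thesis .
  qed
  note deg = this
  have "\<forall>N. \<exists>z\<in>C. K ^ (\<Sum>i\<in>I. k i * m N i) \<le> (\<Prod>i\<in>I. f i z ^ m N i)"
  proof
    fix N
    show "\<exists>z\<in>C. K ^ (\<Sum>i\<in>I. k i * m N i) \<le> (\<Prod>i\<in>I. f i z ^ m N i)"
      by (rule prod) (simp add: m_def)
  qed
  then obtain Z where Z: "\<And>N. Z N \<in> C"
    "\<And>N. K ^ (\<Sum>i\<in>I. k i * m N i) \<le> (\<Prod>i\<in>I. f i (Z N) ^ m N i)"
    by metis
  \<comment> \<open>All other factors are at most one, so each factor alone dominates the lower bound of the product.\<close>
  have bound: "K powr ((1 + s / N) * (k i / w i)) \<le> f i (Z N)"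
    if "i \<in> I" "w i > 0" "N > 0" for i N
  proof -
    let ?x = "f i (Z N)"
    have "K powr (N + s) \<le> K ^ (\<Sum>i\<in>I. k i * m N i)"
      using \<open>0 < K\<close> \<open>K < 1\<close> deg[of N] by (simp flip: powr_realpow add: powr_mono')
    also note Z(2)
    also have "(\<Prod>i\<in>I. f i (Z N) ^ m N i) = ?x ^ m N i * (\<Prod>i\<in>I - {i}. f i (Z N) ^ m N i)"
      using \<open>finite I\<close> \<open>i \<in> I\<close> by (rule prod.remove)
    also have "\<dots> \<le> ?x ^ m N i"
      using f01 Z(1) \<open>i \<in> I\<close> by (intro mult_left_le prod_le_1) (auto simp: power_le_one)
    finally have le: "K powr (N + s) \<le> ?x ^ m N i" .
    moreover have "K powr (N + s) > 0" using \<open>0 < K\<close> by simp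
    ultimately have "?x ^ m N i > 0" by linarith
    moreover have "m N i \<noteq> 0" by (simp add: m_def)
    ultimately have "?x \<noteq> 0" by (auto simp: power_0_left)
    then have x: "0 < ?x" using f01[OF that(1) Z(1)[of N]] by simp
    have "ln (K powr (N + s)) \<le> ln (?x ^ m N i)"
      using le \<open>K powr (N + s) > 0\<close> by (rule ln_mono)
    then have "(N + s) * ln K \<le> m N i * ln ?x"
      using \<open>0 < K\<close> x by (simp only: ln_realpow ln_powr)
    also have "\<dots> \<le> (real N * w i / k i) * ln ?x"
      using m_ge[of N i] f01[OF that(1) Z(1)[of N]] x by (intro mult_right_mono_neg) auto
    finally have "(1 + s / N) * (k i / w i) * ln K \<le> ln ?x"
      using that k[OF that(1)] by (simp add: field_simps)
    then have "exp ((1 + s / N) * (k i / w i) * ln K) \<le> ?x"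
      using x by (metis exp_le_cancel_iff exp_ln)
    then show ?thesis using \<open>0 < K\<close> by (simp add: powr_def)
  qed
  obtain z r where z: "z \<in> C" and r: "strict_mono r" "(Z \<circ> r) \<longlonglongrightarrow> z"
    using \<open>compact C\<close> Z(1) unfolding compact_def by metis
  have "K powr (k i / w i) \<le> f i z" if i: "i \<in> I" "w i > 0" for i
  proof (rule LIMSEQ_le)
    show "(\<lambda>j. f i (Z (r j))) \<longlonglongrightarrow> f i z"
      using cont[OF i(1)] r(2) z Z(1) unfolding continuous_on_sequentially by (auto simp: o_def)
    have "(\<lambda>N. s / real N) \<longlonglongrightarrow> 0" by (rule lim_const_over_n)
    then have "(\<lambda>N. K powr ((1 + s / real N) * (k i / w i))) \<longlonglongrightarrow> K powr ((1 + 0) * (k i / w i))"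
      using \<open>0 < K\<close> by (intro tendsto_intros) auto
    from LIMSEQ_subseq_LIMSEQ[OF this r(1)]
    show "(\<lambda>j. K powr ((1 + s / real (r j)) * (k i / w i))) \<longlonglongrightarrow> K powr (k i / w i)"
      by (simp add: o_def)
    have "r j > 0" if "j \<ge> 1" for j
      using seq_suble[OF r(1), of j] that by linarith
    then show "\<exists>N. \<forall>j\<ge>N. K powr ((1 + s / real (r j)) * (k i / w i)) \<le> f i (Z (r j))"
      using bound[OF i] by blast
  qed
  then show ?thesis using z by blast
qed

section \<open>The weights are admissible\<close>

text \<open>Jensen's inequality for \<open>-1 / ln\<close>, proved by summing the tangent line at \<open>c\<close>. The tangent line
  lies above the function on the interval up to \<open>exp (-2)\<close>, where the second derivative
  \<open>-(ln x + 2) / (x\<^sup>2 * ln x ^ 3)\<close> is nonpositive. The line is increasing, so the sum of the \<open>a i\<close>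
  need only be bounded by \<open>card I * c\<close>. An entry \<open>a i = 0\<close> contributes nothing, because
  \<open>ln 0 = 0\<close> and division by zero gives zero; this is also the limit of \<open>-1 / ln\<close> at zero.\<close>

lemma sum_ln_ratio_le:
  fixes a :: "'i \<Rightarrow> real" and c :: real
  assumes "finite I" and c: "0 < c" "card I * c < exp (-2)"
    and a: "\<And>i. i \<in> I \<Longrightarrow> a i \<ge> 0" "(\<Sum>i\<in>I. a i) \<le> card I * c"
  shows "(\<Sum>i\<in>I. ln c / ln (a i)) \<le> card I"
proof (cases "I = {}")
  case False
  define D where "D = {0<..<exp (-2::real)}"
  have ln2: "ln x < -2" if "x \<in> D" for x :: real
    using that by (metis D_def exp_less_cancel_iff exp_ln greaterThanLessThan_iff)
  have "card I \<ge> 1" using False \<open>finite I\<close> by (simp add: Suc_leI card_gt_0_iff)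
  then have "c \<le> card I * c" using c(1) by simp
  then have "c < exp (-2)" using c(2) by (rule le_less_trans)
  then have cD: "c \<in> D" using c(1) by (simp add: D_def)
  have tangent: "1 / (c * (ln c)\<^sup>2) * (x - c) \<ge> - 1 / ln x + 1 / ln c" if "x \<in> D" for x
  proof -
    have "- 1 / (c * (ln c)\<^sup>2) * (x - c) \<le> 1 / ln x - 1 / ln c"
    proof (rule f''_imp_f'[where C = D and f'' = "\<lambda>x. (ln x + 2) / (x\<^sup>2 * (ln x) ^ 3)"])
      show "convex D" by (simp add: D_def)
      fix x :: real assume x: "x \<in> D"
      then have x': "x > 0" "ln x < -2" using ln2 by (auto simp: D_def)
      then have "ln x \<noteq> 0" by linarith
      show "((\<lambda>x. 1 / ln x) has_real_derivative - 1 / (x * (ln x)\<^sup>2)) (at x)"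
        using x' \<open>ln x \<noteq> 0\<close>
        by (auto intro!: derivative_eq_intros simp: field_simps power2_eq_square)
      show "((\<lambda>x. - 1 / (x * (ln x)\<^sup>2)) has_real_derivative (ln x + 2) / (x\<^sup>2 * (ln x) ^ 3)) (at x)"
        using x' \<open>ln x \<noteq> 0\<close>
        by (auto intro!: derivative_eq_intros
            simp: divide_simps power2_eq_square power3_eq_cube) (simp add: algebra_simps)
      have "ln x < 0" using x' by linarith
      then have "(ln x) ^ 3 < 0" by simp
      then show "0 \<le> (ln x + 2) / (x\<^sup>2 * (ln x) ^ 3)"
        using x' by (intro divide_nonpos_neg mult_pos_neg) auto
    qed (use cD that in auto)
    then show ?thesis by (simp add: field_simps)
  qed
  \<comment> \<open>The tangent inequality, multiplied by \<open>- ln c\<close> and extended to zero.\<close>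
  have tangent': "ln c / ln (a i) \<le> 1 - (a i - c) / (c * ln c)" if i: "i \<in> I" for i
  proof (cases "a i = 0")
    case True
    have "1 + 1 / ln c \<ge> 0" using ln2[OF cD] by (simp add: field_simps)
    then show ?thesis using True c(1) by simp
  next
    case False
    have "a i \<le> (\<Sum>i\<in>I. a i)" using i a(1) \<open>finite I\<close> by (intro member_le_sum) auto
    then have "a i \<in> D" using False a c i by (auto simp: D_def order.strict_iff_order)
    from tangent[OF this] have
      "- ln c * (- 1 / ln (a i) + 1 / ln c) \<le> - ln c * (1 / (c * (ln c)\<^sup>2) * (a i - c))"
      using ln2[OF cD] by (intro mult_left_mono) auto
    moreover have "ln c \<noteq> 0" using ln2[OF cD] by linarith
    moreover from this have "- ln c * (- 1 / ln (a i) + 1 / ln c) = ln c / ln (a i) - 1"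
      by (simp add: algebra_simps)
    moreover have "- ln c * (1 / (c * (ln c)\<^sup>2) * (a i - c)) = - ((a i - c) / (c * ln c))"
      using \<open>ln c \<noteq> 0\<close> c(1) by (simp add: power2_eq_square divide_simps)
    ultimately show ?thesis by linarith
  qed
  have "(\<Sum>i\<in>I. ln c / ln (a i)) \<le> (\<Sum>i\<in>I. 1 - (a i - c) / (c * ln c))"
    by (intro sum_mono tangent')
  also have "\<dots> = card I - ((\<Sum>i\<in>I. a i) - card I * c) / (c * ln c)"
    by (simp add: sum_subtractf flip: sum_divide_distrib)
  also have "\<dots> \<le> card I"
  proof -
    have "ln c < 0" using ln2[OF cD] by linarith
    with c(1) have "c * ln c < 0" by (rule mult_pos_neg)
    then show ?thesis using a(2) by (simp add: divide_nonpos_neg)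
  qed
  finally show ?thesis .
qed simp

section \<open>The plank theorem\<close>

theorem proposition1p7:
  fixes scl :: "'k::real_or_complex \<Rightarrow> 'a::banach \<Rightarrow> 'a"
    and n :: nat and K :: real
    and P :: "nat \<Rightarrow> 'a \<Rightarrow> 'k" and k :: "nat \<Rightarrow> nat" and a :: "nat \<Rightarrow> real"
  assumes "normed_space_over scl"
    and "\<exists>B. finite_dimensional_vector_space scl B"
    and "n \<ge> 1"
    and "K > 0" and "K < 1 / root n (real n * (exp 1)\<^sup>2)"
    and "\<And>(Q :: nat \<Rightarrow> 'a \<Rightarrow> 'k) (m :: nat \<Rightarrow> nat).
          (\<And>i. i \<in> {1..n} \<Longrightarrow>
            m i \<ge> 1 \<and> continuous_polynomial_of_degree scl (m i) (Q i) \<and> poly_norm (Q i) = 1) \<Longrightarrow>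
          poly_norm (\<lambda>z. \<Prod>i=1..n. Q i z) \<ge> K ^ (\<Sum>i=1..n. m i) * (\<Prod>i=1..n. poly_norm (Q i))"
    and "\<And>i. i \<in> {1..n} \<Longrightarrow> k i \<ge> 1"
    and "\<And>i. i \<in> {1..n} \<Longrightarrow> continuous_polynomial_of_degree scl (k i) (P i)"
    and "\<And>i. i \<in> {1..n} \<Longrightarrow> poly_norm (P i) = 1"
    and "\<And>i. i \<in> {1..n} \<Longrightarrow> a i \<ge> 0"
    and "(\<Sum>i=1..n. a i) \<le> real n * K ^ n"
  shows "\<exists>z0 \<in> cball 0 1. \<forall>i\<in>{1..n}. norm (P i z0) \<ge> a i ^ k i"
proof -
  note K = assms(4,5) and prod_bound = assms(6) and k = assms(7) and P = assms(8,9)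
    and a = assms(10,11)
  interpret normed_space_over scl by fact
  have vs: "vector_space scl" by unfold_locales
  have compact: "compact (cball (0::'a) 1)"
    using assms(2) compact_cball_finite_dimensional by blast
  have cont: "continuous_on (cball 0 1) (P i)" if "i \<in> {1..n}" for i
    using continuous_on_polynomial[OF vs P(1)[OF that]] .
  have nK: "n * K ^ n < exp (-2)"
  proof -
    let ?r = "root n (real n * (exp 1)\<^sup>2)"
    have pos: "real n * (exp 1)\<^sup>2 > 0" using \<open>n \<ge> 1\<close> by simp
    then have "?r > 0" using \<open>n \<ge> 1\<close> by (simp add: real_root_gt_zero)
    then have "K * ?r < 1" using K(2) by (simp add: field_simps)
    then have "(K * ?r) ^ n < 1"
      using K(1) \<open>?r > 0\<close> \<open>n \<ge> 1\<close> by (intro power_less_one_iff[THEN iffD2]) auto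
    then have "K ^ n * (n * (exp 1)\<^sup>2) < 1"
      using pos \<open>n \<ge> 1\<close> by (simp add: power_mult_distrib)
    moreover have "(exp 1 :: real)\<^sup>2 = exp 2" by (simp flip: exp_of_nat_mult)
    ultimately show ?thesis by (simp add: exp_minus field_simps)
  qed
  have "K < 1"
  proof (rule ccontr)
    assume "\<not> K < 1"
    then have "1 * 1 \<le> n * K ^ n" using \<open>n \<ge> 1\<close> by (intro mult_mono) auto
    then show False using nK by (smt (verit) exp_le_one_iff)
  qed
  \<comment> \<open>The weights that make \<open>K powr (k i / w i)\<close> equal to \<open>a i ^ k i\<close>; zero if \<open>a i = 0\<close>.\<close>
  define w where "w = (\<lambda>i. ln K / ln (a i))"
  have a_less_1: "a i < 1" if "i \<in> {1..n}" for i
  proof -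
    have "a i \<le> (\<Sum>i=1..n. a i)" using that a(1) by (intro member_le_sum) auto
    also have "\<dots> < exp (-2)" using a(2) nK by linarith
    also have "\<dots> \<le> 1" by simp
    finally show ?thesis .
  qed
  have w_nonneg: "w i \<ge> 0" if "i \<in> {1..n}" for i
  proof (cases "a i = 0")
    case False
    then have "ln (a i) \<le> 0" using a(1) a_less_1 that by (smt (verit) ln_le_zero_iff)
    then show ?thesis using K(1) \<open>K < 1\<close> by (simp add: w_def divide_nonpos_nonpos)
  qed (simp add: w_def)
  have w_sum: "(\<Sum>i=1..n. w i) \<le> 1"
  proof -
    have "(\<Sum>i=1..n. ln (K ^ n) / ln (a i)) \<le> n"
      using sum_ln_ratio_le[where I = "{1..n}" and c = "K ^ n" and a = a] a nK K(1) by simp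
    then have "n * (\<Sum>i=1..n. w i) \<le> n"
      using K(1) by (simp add: w_def ln_realpow sum_distrib_left)
    then show ?thesis using \<open>n \<ge> 1\<close> by simp
  qed
  have "\<exists>z\<in>cball 0 1. \<forall>i\<in>{1..n}. w i > 0 \<longrightarrow> K powr (k i / w i) \<le> norm (P i z)"
  proof (rule ex_weighted_point[OF _ compact K(1) \<open>K < 1\<close>])
    show "continuous_on (cball 0 1) (\<lambda>z. norm (P i z))" if "i \<in> {1..n}" for i
      by (intro continuous_on_norm cont that)
    show "0 \<le> norm (P i z) \<and> norm (P i z) \<le> 1" if "i \<in> {1..n}" "z \<in> cball 0 1" for i z
      using poly_norm_attained[OF compact cont[OF that(1)]] P(2)[OF that(1)] that(2) by force
  next
    fix m :: "nat \<Rightarrow> nat"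
    assume m: "\<And>i. i \<in> {1..n} \<Longrightarrow> m i \<ge> 1"
    have norm_1: "poly_norm (\<lambda>z. P i z ^ m i) = 1" if "i \<in> {1..n}" for i
      by (rule poly_norm_power_eq_1[OF compact cont[OF that] P(2)[OF that]])
    have "K ^ (\<Sum>i=1..n. k i * m i) * (\<Prod>i=1..n. poly_norm (\<lambda>z. P i z ^ m i))
        \<le> poly_norm (\<lambda>z. \<Prod>i=1..n. P i z ^ m i)"
    proof (rule prod_bound)
      fix i assume i: "i \<in> {1..n}"
      have "1 * 1 \<le> k i * m i" using k[OF i] m[OF i] by (rule mult_le_mono)
      then show "1 \<le> k i * m i \<and> continuous_polynomial_of_degree scl (k i * m i) (\<lambda>z. P i z ^ m i)
          \<and> poly_norm (\<lambda>z. P i z ^ m i) = 1"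
        using continuous_polynomial_of_degree_power[OF vs P(1)[OF i]] norm_1[OF i] by simp
    qed
    then have le: "K ^ (\<Sum>i=1..n. k i * m i) \<le> poly_norm (\<lambda>z. \<Prod>i=1..n. P i z ^ m i)"
      using norm_1 by simp
    have "continuous_on (cball 0 1) (\<lambda>z. \<Prod>i=1..n. P i z ^ m i)"
      by (intro continuous_on_prod continuous_on_power cont)
    from poly_norm_attained[OF compact this] obtain z where "z \<in> cball 0 1"
      "norm (\<Prod>i=1..n. P i z ^ m i) = poly_norm (\<lambda>z. \<Prod>i=1..n. P i z ^ m i)" .
    then show "\<exists>z\<in>cball 0 1. K ^ (\<Sum>i=1..n. k i * m i) \<le> (\<Prod>i=1..n. norm (P i z) ^ m i)"
      using le by (intro bexI[of _ z]) (simp_all add: norm_power flip: prod_norm)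
  qed (use k w_nonneg w_sum in auto)
  then obtain z where z: "z \<in> cball 0 1"
    "\<And>i. i \<in> {1..n} \<Longrightarrow> w i > 0 \<Longrightarrow> K powr (k i / w i) \<le> norm (P i z)" by blast
  have "a i ^ k i \<le> norm (P i z)" if i: "i \<in> {1..n}" for i
  proof (cases "a i = 0")
    case True
    then show ?thesis using k[OF i] by (simp add: power_0_left)
  next
    case False
    then have "a i > 0" using a(1)[OF i] by simp
    then have "ln (a i) < 0" "ln K < 0" using a_less_1[OF i] K(1) \<open>K < 1\<close> by auto
    then have "w i > 0" by (simp add: w_def divide_neg_neg)
    have "K powr (k i / w i) = exp (k i * ln (a i))"
      using K(1) \<open>ln K < 0\<close> by (simp add: powr_def w_def)
    also have "\<dots> = a i ^ k i" using \<open>a i > 0\<close> by (simp add: exp_of_nat_mult)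
    finally show ?thesis using z(2)[OF i \<open>w i > 0\<close>] by simp
  qed
  then show ?thesis using z(1) by blast
qed

end
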